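(* A displacement field $\mathbf{u}:\Omega\to\mathbb{R}^3$ is universal for the triclinic class $\mathbb{Z}_2^c$ of linear strain-gradient elastic solids if and only if it is a homogeneous displacement field.
   Context: $\Omega\subset\mathbb{R}^3$ is a nonempty convex open set with Cartesian coordinates $(x_1,x_2,x_3)$. Repeated indices are summed over $1,2,3$ and a comma denotes partial differentiation. A displacement field is a smooth map $\mathbf{u}:\Omega\to\mathbb{R}^3$, with strain $e_{lm}=\tfrac12(u_{l,m}+u_{m,l})$. It is homogeneous if $\mathbf{u}(\mathbf{x})=\mathbf{H}\mathbf{x}+\mathbf{b}$ for a constant matrix $\mathbf{H}$ and constant vector $\mathbf{b}$. A strain-gradient material is a triple $(\mathsf{C},\mathsf{M},\mathsf{A})$ of constant real tensors of orders $4,5,6$ with index symmetries $\mathsf{C}_{ijlm}=\mathsf{C}_{jilm}=\mathsf{C}_{lmij}$, $\mathsf{M}_{ijklm}=\mathsf{M}_{jiklm}=\mathsf{M}_{ijlkm}$, $\mathsf{A}_{ijklmn}=\mathsf{A}_{jiklmn}=\mathsf{A}_{lmnijk}$. Its stress and hyper-stress are $\sigma_{ij}=\mathsf{C}_{ijlm}e_{lm}+\mathsf{M}_{ijlmn}e_{lm,n}$ and $\tau_{ijk}=\mathsf{M}_{lmijk}e_{lm}+\mathsf{A}_{ijklmn}e_{lm,n}$, and the equilibrium equations without body forces are $\sigma_{ij,j}-\tau_{ijk,jk}=0$ in $\Omega$ for $i=1,2,3$. The triclinic class $\mathbb{Z}_2^c$ (where $\mathbb{Z}_2^c=\{I,-I\}$)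 is the set of all materials $(\mathsf{C},\mathsf{M},\mathsf{A})$ with these index symmetries and $\mathsf{M}=0$ ($21+171=192$ independent constants). A displacement field is universal for the class if it satisfies the equilibrium equations for every material in the class. *)

theory Defs
  imports "HOL-Analysis.Analysis"
begin

text \<open>
  Fields are total functions on \<open>real ^ 3\<close>; every notion below evaluates them and their
  derivatives only at points of an open set \<open>\<Omega>\<close>, so values outside \<open>\<Omega>\<close> are irrelevant.
\<close>

definition pd :: "3 \<Rightarrow> (real ^ 3 \<Rightarrow> real) \<Rightarrow> real ^ 3 \<Rightarrow> real" where
  "pd m f x = deriv (\<lambda>t. f (x + t *\<^sub>R axis m 1)) 0"

text \<open>
  \<open>C^k\<close> on an open set. The differentiability conjunct guarantees that the partial
  derivatives exist (\<^const>\<open>deriv\<close> is total); for open sets and continuous partial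
  derivatives it is equivalent to their mere existence.
\<close>

fun Ck_on :: "nat \<Rightarrow> (real ^ 3) set \<Rightarrow> (real ^ 3 \<Rightarrow> real) \<Rightarrow> bool" where
  "Ck_on 0 \<Omega> f \<longleftrightarrow> continuous_on \<Omega> f"
| "Ck_on (Suc k) \<Omega> f \<longleftrightarrow> f differentiable_on \<Omega> \<and> (\<forall>m. Ck_on k \<Omega> (pd m f))"

definition displacement_field :: "(real ^ 3) set \<Rightarrow> (real ^ 3 \<Rightarrow> real ^ 3) \<Rightarrow> bool" where
  "displacement_field \<Omega> u \<longleftrightarrow> (\<forall>i k. Ck_on k \<Omega> (\<lambda>x. u x $ i))"

definition homogeneous_on :: "(real ^ 3) set \<Rightarrow> (real ^ 3 \<Rightarrow> real ^ 3) \<Rightarrow> bool" where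
  "homogeneous_on \<Omega> u \<longleftrightarrow> (\<exists>(H :: real ^ 3 ^ 3) b. \<forall>x\<in>\<Omega>. u x = H *v x + b)"

definition strain :: "(real ^ 3 \<Rightarrow> real ^ 3) \<Rightarrow> 3 \<Rightarrow> 3 \<Rightarrow> real ^ 3 \<Rightarrow> real" where
  "strain u l m x = (pd m (\<lambda>y. u y $ l) x + pd l (\<lambda>y. u y $ m) x) / 2"

type_synonym tensor4 = "3 \<Rightarrow> 3 \<Rightarrow> 3 \<Rightarrow> 3 \<Rightarrow> real"
type_synonym tensor5 = "3 \<Rightarrow> 3 \<Rightarrow> 3 \<Rightarrow> 3 \<Rightarrow> 3 \<Rightarrow> real"
type_synonym tensor6 = "3 \<Rightarrow> 3 \<Rightarrow> 3 \<Rightarrow> 3 \<Rightarrow> 3 \<Rightarrow> 3 \<Rightarrow> real"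

type_synonym moduli = "tensor4 \<times> tensor5 \<times> tensor6"

definition strain_gradient_materials :: "moduli set" where
  "strain_gradient_materials = {(C, M, A).
     (\<forall>i j l m. C i j l m = C j i l m \<and> C i j l m = C l m i j) \<and>
     (\<forall>i j k l m. M i j k l m = M j i k l m \<and> M i j k l m = M i j l k m) \<and>
     (\<forall>i j k l m n. A i j k l m n = A j i k l m n \<and> A i j k l m n = A l m n i j k)}"

definition triclinic_Z2c :: "moduli set" where
  "triclinic_Z2c = {(C, M, A). (C, M, A) \<in> strain_gradient_materials \<and>
     (\<forall>i j k l m. M i j k l m = 0)}"

fun stress :: "moduli \<Rightarrow> (real ^ 3 \<Rightarrow> real ^ 3) \<Rightarrow> 3 \<Rightarrow> 3 \<Rightarrow> real ^ 3 \<Rightarrow> real" where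
  "stress (C, M, A) u i j x =
     (\<Sum>l\<in>UNIV. \<Sum>m\<in>UNIV. C i j l m * strain u l m x) +
     (\<Sum>l\<in>UNIV. \<Sum>m\<in>UNIV. \<Sum>n\<in>UNIV. M i j l m n * pd n (strain u l m) x)"

fun hyper_stress :: "moduli \<Rightarrow> (real ^ 3 \<Rightarrow> real ^ 3) \<Rightarrow> 3 \<Rightarrow> 3 \<Rightarrow> 3 \<Rightarrow> real ^ 3 \<Rightarrow> real" where
  "hyper_stress (C, M, A) u i j k x =
     (\<Sum>l\<in>UNIV. \<Sum>m\<in>UNIV. M l m i j k * strain u l m x) +
     (\<Sum>l\<in>UNIV. \<Sum>m\<in>UNIV. \<Sum>n\<in>UNIV. A i j k l m n * pd n (strain u l m) x)"

definition equilibrium_on :: "(real ^ 3) set \<Rightarrow> moduli \<Rightarrow> (real ^ 3 \<Rightarrow> real ^ 3) \<Rightarrow> bool" where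
  "equilibrium_on \<Omega> \<mu> u \<longleftrightarrow> (\<forall>x\<in>\<Omega>. \<forall>i.
     (\<Sum>j\<in>UNIV. pd j (stress \<mu> u i j) x) -
     (\<Sum>j\<in>UNIV. \<Sum>k\<in>UNIV. pd k (pd j (hyper_stress \<mu> u i j k)) x) = 0)"

definition universal_for :: "moduli set \<Rightarrow> (real ^ 3) set \<Rightarrow> (real ^ 3 \<Rightarrow> real ^ 3) \<Rightarrow> bool" where
  "universal_for K \<Omega> u \<longleftrightarrow> (\<forall>\<mu>\<in>K. equilibrium_on \<Omega> \<mu> u)"

end

theory Submission
  imports Defs "HOL-Combinatorics.Transposition"
begin

text \<open>
  Purely elastic materials (\<open>A = 0\<close>) of the form \<open>C = S \<otimes> S\<close> already suffice. Equilibrium then reads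
  \<open>S \<nabla>(S : e) = 0\<close>, so \<open>S : e\<close> is constant whenever the symmetric matrix \<open>S\<close> is invertible. Taking
  for \<open>S\<close> signed permutation matrices of transpositions shows that the strain \<open>e\<close> is constant.
  Along segments this gives \<open>(u x - u y) \<bullet> (x - y) = (E (x - y)) \<bullet> (x - y)\<close>, and polarizing this
  identity at a fixed base point shows that \<open>u\<close> is affine, with no need for second derivatives of
  \<open>u\<close> to commute. Conversely, the stresses of a homogeneous field are constant.
\<close>

section \<open>Partial derivatives versus the total derivative\<close>

lemma pd_eq_derivative:
  assumes "(f has_derivative f') (at x)"
  shows "pd m f x = f' (axis m 1)"
proof -
  have "((\<lambda>t::real. x + t *\<^sub>R axis m 1) has_derivative (\<lambda>t. t *\<^sub>R axis m 1)) (at 0)"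
    by (auto intro!: derivative_eq_intros)
  then have "((\<lambda>t. f (x + t *\<^sub>R axis m 1)) has_derivative (\<lambda>t. f' (t *\<^sub>R axis m 1))) (at 0)"
    using assms has_derivative_compose[of "\<lambda>t::real. x + t *\<^sub>R axis m 1" _ 0 UNIV f f'] by simp
  moreover have "f' (t *\<^sub>R axis m 1) = f' (axis m 1) * t" for t
    using linear_cmul[OF has_derivative_linear[OF assms]] by simp
  ultimately show ?thesis
    unfolding pd_def by (intro DERIV_imp_deriv) (simp add: has_field_derivative_def)
qed

text \<open>A derivative is linear, so its values on the basis vectors determine it. This form
  serves for vanishing gradients and for the chain rule along segments.\<close>

lemma has_derivative_pd:
  assumes "f differentiable (at x)"
  shows "(f has_derivative (\<lambda>h. \<Sum>m\<in>UNIV. h $ m * pd m f x)) (at x)"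
proof -
  from assms obtain f' where f': "(f has_derivative f') (at x)"
    by (auto simp: differentiable_def)
  note lin = has_derivative_linear[OF f']
  have "f' h = (\<Sum>m\<in>UNIV. h $ m * pd m f x)" for h
  proof -
    have "f' h = f' (\<Sum>m\<in>UNIV. h $ m *\<^sub>R axis m 1)"
      using basis_expansion[of h] by (simp add: scalar_mult_eq_scaleR)
    also have "\<dots> = (\<Sum>m\<in>UNIV. h $ m * f' (axis m 1))"
      by (simp add: linear_sum[OF lin] linear_cmul[OF lin])
    finally show ?thesis by (simp add: pd_eq_derivative[OF f'])
  qed
  then have "f' = (\<lambda>h. \<Sum>m\<in>UNIV. h $ m * pd m f x)" by blast
  with f' show ?thesis by simp
qed

text \<open>The derivative at \<open>0\<close> sees only a short piece of the coordinate line, which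
  stays in the open set. Identities known only on \<open>\<Omega>\<close> can thus be
  differentiated.\<close>

lemma pd_transform_open:
  assumes "open \<Omega>" "x \<in> \<Omega>" "\<And>y. y \<in> \<Omega> \<Longrightarrow> f y = g y"
  shows "pd m f x = pd m g x"
  unfolding pd_def
proof (rule deriv_cong_ev)
  have "((\<lambda>t::real. x + t *\<^sub>R axis m 1) \<longlongrightarrow> x + 0 *\<^sub>R axis m 1) (nhds 0)"
    by (intro tendsto_intros filterlim_ident)
  then have "\<forall>\<^sub>F t::real in nhds 0. x + t *\<^sub>R axis m 1 \<in> \<Omega>"
    using assms(1,2) by (auto dest: topological_tendstoD)
  then show "\<forall>\<^sub>F t in nhds 0. f (x + t *\<^sub>R axis m 1) = g (x + t *\<^sub>R axis m 1)"
    by eventually_elim (rule assms(3))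
qed simp

lemma pd_const [simp]: "pd m (\<lambda>x. c) = (\<lambda>x. 0)"
  by (simp add: pd_def fun_eq_iff)

lemma pd_const_on:
  assumes "open \<Omega>" "x \<in> \<Omega>" "\<And>y. y \<in> \<Omega> \<Longrightarrow> f y = c"
  shows "pd m f x = 0"
  using pd_transform_open[OF assms] by simp

lemma pd_linear_combination:
  assumes "finite I" "\<And>i. i \<in> I \<Longrightarrow> f i differentiable (at x)"
  shows "pd m (\<lambda>y. \<Sum>i\<in>I. c i * f i y) x = (\<Sum>i\<in>I. c i * pd m (f i) x)"
proof -
  have "((\<lambda>y. \<Sum>i\<in>I. c i * f i y) has_derivative
      (\<lambda>h. \<Sum>i\<in>I. c i * (\<Sum>m\<in>UNIV. h $ m * pd m (f i) x))) (at x)"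
    using assms by (intro has_derivative_sum has_derivative_mult_right has_derivative_pd)
  then have "pd m (\<lambda>y. \<Sum>i\<in>I. c i * f i y) x =
      (\<Sum>i\<in>I. c i * (\<Sum>k\<in>UNIV. axis m 1 $ k * pd k (f i) x))"
    by (rule pd_eq_derivative)
  then show ?thesis
    by (simp add: axis_def if_distrib[where f = "\<lambda>a. a * _"] cong: if_cong)
qed

lemma constant_on_if_pd_zero:
  assumes "open \<Omega>" "convex \<Omega>" "f differentiable_on \<Omega>"
    and "\<And>x m. x \<in> \<Omega> \<Longrightarrow> pd m f x = 0"
  obtains c where "\<And>x. x \<in> \<Omega> \<Longrightarrow> f x = c"
proof -
  have "(f has_derivative (\<lambda>h. 0)) (at x within \<Omega>)" if "x \<in> \<Omega>" for x
    using has_derivative_pd[of f x] assms(1,3,4) that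
    by (auto simp: differentiable_on_eq_differentiable_at intro: has_derivative_at_withinI)
  then show thesis
    using has_derivative_zero_constant[OF assms(2)] that by blast
qed

section \<open>A universal displacement field has constant strain\<close>

lemma displacement_field_differentiable:
  assumes "displacement_field \<Omega> u" "open \<Omega>" "x \<in> \<Omega>"
  shows "(\<lambda>y. u y $ i) differentiable (at x)" "pd m (\<lambda>y. u y $ i) differentiable (at x)"
proof -
  have "Ck_on (Suc (Suc 0)) \<Omega> (\<lambda>y. u y $ i)"
    using assms(1) unfolding displacement_field_def by blast
  then show "(\<lambda>y. u y $ i) differentiable (at x)" "pd m (\<lambda>y. u y $ i) differentiable (at x)"
    using assms(2,3) by (auto simp: differentiable_on_eq_differentiable_at)
qed

lemma strain_differentiable:
  assumes "displacement_field \<Omega> u" "open \<Omega>" "x \<in> \<Omega>"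
  shows "strain u l m differentiable (at x)"
  unfolding strain_def[abs_def]
  using displacement_field_differentiable(2)[OF assms]
  by (intro differentiable_divide differentiable_add) auto

lemma strain_commute: "strain u l m x = strain u m l x"
  by (simp add: strain_def)

text \<open>Each material \<open>S \<otimes> S\<close> with \<open>S\<close> a signed matrix of the
  transposition of \<open>p\<close> and \<open>q\<close> makes one signed sum of strain components
  stationary. Adding two such sums with suitable signs isolates the component \<open>p q\<close>;
  for \<open>p = q\<close> the permutation is the identity.\<close>

lemma universal_strain_constant:
  assumes u: "displacement_field \<Omega> u" and univ: "universal_for triclinic_Z2c \<Omega> u"
    and \<Omega>: "open \<Omega>" "x \<in> \<Omega>"
  shows "pd n (strain u p q) x = 0"
proof -
  define \<pi> where "\<pi> = Transposition.transpose p q"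
  have \<pi>\<pi>: "\<pi> (\<pi> i) = i" for i by (simp add: \<pi>_def)
  have \<pi>_iff: "j = \<pi> i \<longleftrightarrow> i = \<pi> j" for i j by (metis \<pi>\<pi>)
  note diff = strain_differentiable[OF u \<Omega>]
  have key: "(\<Sum>l\<in>UNIV. s l * pd n (strain u l (\<pi> l)) x) = 0"
    if s: "\<And>i. s (\<pi> i) = s i" "\<And>i. s i \<noteq> 0" for s :: "3 \<Rightarrow> real"
  proof -
    define T where "T = (\<lambda>y. \<Sum>l\<in>UNIV. s l * strain u l (\<pi> l) y)"
    \<comment> \<open>Symmetric because \<open>\<pi>\<close> is an involution and \<open>s\<close>
      is \<open>\<pi>\<close>-invariant; \<open>T\<close> is the contraction
      \<open>S : e\<close>.\<close>
    define S where "S i j = (if j = \<pi> i then s i else 0)" for i j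
    have S_sym: "S i j = S j i" for i j
      using s(1) \<pi>_iff[of i j] by (auto simp: S_def)
    define C where "C = (\<lambda>i j l m. S i j * S l m)"
    define \<mu> :: moduli where "\<mu> = (C, \<lambda>_ _ _ _ _. 0, \<lambda>_ _ _ _ _ _. 0)"
    have "\<mu> \<in> triclinic_Z2c"
      using S_sym by (auto simp: \<mu>_def C_def triclinic_Z2c_def strain_gradient_materials_def)
    moreover have "hyper_stress \<mu> u i j k = (\<lambda>x. 0)" for i j k
      by (simp add: \<mu>_def fun_eq_iff)
    \<comment> \<open>Row \<open>\<pi> n\<close> of \<open>S\<close> has its only nonzero entry in
      column \<open>n\<close>, so this equation contains only \<open>pd n T\<close>.\<close>
    ultimately have eq: "(\<Sum>j\<in>UNIV. pd j (stress \<mu> u (\<pi> n) j) x) = 0"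
      using univ \<Omega>(2) by (simp add: universal_for_def equilibrium_on_def)
    \<comment> \<open>The one-term sum brings the product into the shape of
      \<open>pd_linear_combination\<close>.\<close>
    have "stress \<mu> u i j = (\<lambda>y. \<Sum>k\<in>{()}. S i j * T y)" for i j
      by (simp add: fun_eq_iff \<mu>_def C_def T_def S_def sum_distrib_left mult.assoc
          if_distrib[where f = "\<lambda>a. a * _"] if_distrib[where f = "\<lambda>a. _ * a"] cong: if_cong)
    moreover have "T differentiable (at x)"
      unfolding T_def by (auto intro!: differentiable_sum differentiable_mult diff)
    ultimately have "pd j (stress \<mu> u i j) x = S i j * pd j T x" for i j
      using pd_linear_combination[of "{()}" "\<lambda>_. T" x j "\<lambda>_. S i j"] by simp
    with eq have "s (\<pi> n) * pd n T x = 0"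
      by (simp add: S_def \<pi>\<pi> if_distrib[where f = "\<lambda>a. a * _"] cong: if_cong)
    with s(2) have "pd n T x = 0" by simp
    then show ?thesis
      unfolding T_def using pd_linear_combination[of UNIV _ x n s] diff by simp
  qed
  \<comment> \<open>Added to the all-ones choice, these signs give weight 2 on \<open>{p, q}\<close>
    and cancel every other term.\<close>
  define s :: "3 \<Rightarrow> real" where "s l = (if l \<in> {p, q} then 1 else - 1)" for l
  have s: "s (\<pi> i) = s i" "s i \<noteq> 0" for i
    by (auto simp: s_def \<pi>_def Transposition.transpose_def)
  have "(\<Sum>l\<in>UNIV. (1 + s l) * pd n (strain u l (\<pi> l)) x) = 0"
    using key[of "\<lambda>_. 1"] key[of s, OF s] by (simp add: distrib_right sum.distrib)
  moreover have "(\<Sum>l\<in>UNIV. (1 + s l) * pd n (strain u l (\<pi> l)) x) =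
      (\<Sum>l\<in>{p, q}. (1 + s l) * pd n (strain u l (\<pi> l)) x)"
    by (rule sum.mono_neutral_right) (auto simp: s_def)
  moreover have "strain u q p = strain u p q"
    by (simp add: fun_eq_iff strain_commute)
  ultimately show ?thesis
    by (cases "p = q") (auto simp: s_def \<pi>_def)
qed

section \<open>Integration of a constant strain to an affine field\<close>

lemma inner_increment_of_constant_strain:
  assumes \<Omega>: "open \<Omega>" "convex \<Omega>" and u: "displacement_field \<Omega> u"
    and E: "\<And>x l m. x \<in> \<Omega> \<Longrightarrow> strain u l m x = E $ l $ m" and xy: "x \<in> \<Omega>" "y \<in> \<Omega>"
  shows "(u y - u x) \<bullet> (y - x) = (E *v (y - x)) \<bullet> (y - x)"
proof -
  define d where "d = y - x"
  let ?\<gamma> = "\<lambda>t::real. x + t *\<^sub>R d"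
  let ?\<phi> = "\<lambda>t. u (?\<gamma> t) \<bullet> d"
  have in\<Omega>: "?\<gamma> t \<in> \<Omega>" if "0 \<le> t" "t \<le> 1" for t
    using convexD_alt[OF \<Omega>(2) xy, of t] that by (simp add: d_def algebra_simps)
  have "(?\<phi> has_derivative (\<lambda>h. (E *v d) \<bullet> d * h)) (at t)" if t: "0 \<le> t" "t \<le> 1" for t
  proof -
    note df = has_derivative_pd[OF displacement_field_differentiable(1)[OF u \<Omega>(1) in\<Omega>[OF t]]]
    have "(?\<gamma> has_derivative (\<lambda>h. h *\<^sub>R d)) (at t)"
      by (auto intro!: derivative_eq_intros)
    from has_derivative_compose[OF this df]
    have "((\<lambda>t. u (?\<gamma> t) $ l) has_derivative
        (\<lambda>h. \<Sum>m\<in>UNIV. (h *\<^sub>R d) $ m * pd m (\<lambda>y. u y $ l) (?\<gamma> t))) (at t)" for l .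
    then have "((\<lambda>t. \<Sum>l\<in>UNIV. u (?\<gamma> t) $ l * d $ l) has_derivative
        (\<lambda>h. \<Sum>l\<in>UNIV. (\<Sum>m\<in>UNIV. (h *\<^sub>R d) $ m * pd m (\<lambda>y. u y $ l) (?\<gamma> t)) * d $ l)) (at t)"
      by (intro has_derivative_sum has_derivative_mult_left)
    moreover have "(\<Sum>l\<in>UNIV. (\<Sum>m\<in>UNIV. (h *\<^sub>R d) $ m * pd m (\<lambda>y. u y $ l) (?\<gamma> t)) * d $ l)
        = (E *v d) \<bullet> d * h" for h
    proof -
      let ?g = "\<lambda>l m. pd m (\<lambda>y. u y $ l) (?\<gamma> t)"
      \<comment> \<open>Only the symmetric part of the gradient contributes to a quadratic form:
        exchanging the summation indices identifies the two halves.\<close>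
      have Eg: "E $ l $ m = (?g l m + ?g m l) / 2" for l m
        using E[OF in\<Omega>[OF t], of l m] by (simp add: strain_def)
      have "(E *v d) \<bullet> d * h =
          (\<Sum>l\<in>UNIV. \<Sum>m\<in>UNIV. (?g l m + ?g m l) / 2 * d $ m * d $ l * h)"
        by (simp add: inner_vec_def matrix_vector_mult_def sum_distrib_right Eg)
      also have "\<dots> = (\<Sum>l\<in>UNIV. \<Sum>m\<in>UNIV. ?g l m * d $ m * d $ l * h) / 2 +
          (\<Sum>l\<in>UNIV. \<Sum>m\<in>UNIV. ?g m l * d $ m * d $ l * h) / 2"
        by (simp add: sum_divide_distrib sum.distrib algebra_simps add_divide_distrib)
      also have "(\<Sum>l\<in>UNIV. \<Sum>m\<in>UNIV. ?g m l * d $ m * d $ l * h) =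
          (\<Sum>l\<in>UNIV. \<Sum>m\<in>UNIV. ?g l m * d $ m * d $ l * h)"
        by (subst sum.swap) (simp add: mult_ac)
      finally show ?thesis by (simp add: sum_distrib_right sum_distrib_left mult_ac)
    qed
    ultimately show ?thesis by (simp add: inner_vec_def)
  qed
  then have "(?\<phi> has_real_derivative (E *v d) \<bullet> d) (at t)" if "0 \<le> t" "t \<le> 1" for t
    using that by (simp add: has_field_derivative_def)
  \<comment> \<open>The derivative is the same at every \<open>t\<close>, so the unknown
    intermediate point does not matter.\<close>
  from MVT2[OF _ this, of 0 1] have "?\<phi> 1 - ?\<phi> 0 = (E *v d) \<bullet> d" by auto
  then show ?thesis by (simp add: d_def inner_diff_left)
qed

text \<open>Expanding the hypothesis for \<open>x\<close> and \<open>z\<close> around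
  \<open>x\<^sub>0\<close> leaves only the mixed terms
  \<open>(w z - w x\<^sub>0) \<bullet> (x - x\<^sub>0)\<close> and
  \<open>(w x - w x\<^sub>0) \<bullet> (z - x\<^sub>0)\<close>, whose sum is zero. With
  \<open>z - x\<^sub>0\<close> along an axis, the second term reads off a component of
  \<open>w x - w x\<^sub>0\<close>, and the first is linear in \<open>x - x\<^sub>0\<close>.\<close>

lemma affine_of_skew_increment:
  fixes w :: "real ^ 'n \<Rightarrow> real ^ 'n"
  assumes "open \<Omega>" "x\<^sub>0 \<in> \<Omega>"
    and skew: "\<And>x y. x \<in> \<Omega> \<Longrightarrow> y \<in> \<Omega> \<Longrightarrow> (w y - w x) \<bullet> (y - x) = 0"
  obtains H :: "real ^ 'n ^ 'n" where "\<And>x. x \<in> \<Omega> \<Longrightarrow> w x - w x\<^sub>0 = H *v (x - x\<^sub>0)"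
proof -
  from assms(1,2) obtain r where r: "r > 0" "cball x\<^sub>0 r \<subseteq> \<Omega>"
    by (meson open_contains_cball)
  define z where "z i = x\<^sub>0 + r *\<^sub>R axis i 1" for i
  have z: "z i \<in> \<Omega>" for i
    using r by (auto simp: z_def dist_norm intro!: subsetD[OF r(2)])
  \<comment> \<open>Row \<open>i\<close> is the mixed-term identity for \<open>z i\<close> solved
    for component \<open>i\<close>; the factor \<open>r\<close> is the length of
    \<open>z i - x\<^sub>0\<close>.\<close>
  define H :: "real ^ 'n ^ 'n" where "H = (\<chi> i. (- 1 / r) *\<^sub>R (w (z i) - w x\<^sub>0))"
  have "w x - w x\<^sub>0 = H *v (x - x\<^sub>0)" if x: "x \<in> \<Omega>" for x
  proof (rule vec_eq_iff[THEN iffD2], rule allI)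
    fix i
    have "(w (z i) - w x\<^sub>0) \<bullet> (x - x\<^sub>0) + (w x - w x\<^sub>0) \<bullet> (z i - x\<^sub>0) = 0"
      using skew[OF x z, of i] skew[OF assms(2) x] skew[OF assms(2) z, of i]
      by (simp add: algebra_simps)
    moreover have "(w x - w x\<^sub>0) \<bullet> (z i - x\<^sub>0) = r * (w x - w x\<^sub>0) $ i"
      by (simp add: z_def inner_axis)
    moreover have "(H *v (x - x\<^sub>0)) $ i = - ((w (z i) - w x\<^sub>0) \<bullet> (x - x\<^sub>0)) / r"
      by (simp add: matrix_vector_mul_component H_def)
    ultimately have "r * (w x - w x\<^sub>0) $ i = r * (H *v (x - x\<^sub>0)) $ i"
      using r(1) by simp
    then show "(w x - w x\<^sub>0) $ i = (H *v (x - x\<^sub>0)) $ i"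
      using r(1) by (simp only: mult_cancel_left) simp
  qed
  then show thesis by (rule that)
qed

lemma homogeneous_if_strain_constant:
  assumes \<Omega>: "open \<Omega>" "convex \<Omega>" "x\<^sub>0 \<in> \<Omega>" and u: "displacement_field \<Omega> u"
    and E: "\<And>x l m. x \<in> \<Omega> \<Longrightarrow> strain u l m x = E $ l $ m"
  shows "homogeneous_on \<Omega> u"
proof -
  \<comment> \<open>Removing the strain part leaves an infinitesimal rigid motion, whose increments
    are orthogonal to the displacement of the point.\<close>
  define w where "w x = u x - E *v x" for x
  have "(w y - w x) \<bullet> (y - x) = 0" if "x \<in> \<Omega>" "y \<in> \<Omega>" for x y
    using inner_increment_of_constant_strain[OF \<Omega>(1,2) u E that]
    by (simp add: w_def algebra_simps matrix_vector_mult_diff_distrib)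
  from affine_of_skew_increment[OF \<Omega>(1,3) this] obtain H :: "real ^ 3 ^ 3"
    where H: "\<And>x. x \<in> \<Omega> \<Longrightarrow> w x - w x\<^sub>0 = H *v (x - x\<^sub>0)" by blast
  have "u x = (E + H) *v x + (w x\<^sub>0 - H *v x\<^sub>0)" if "x \<in> \<Omega>" for x
    using H[OF that]
    by (simp add: w_def matrix_vector_mult_diff_distrib matrix_vector_mult_add_rdistrib algebra_simps)
  then show ?thesis unfolding homogeneous_on_def by blast
qed

section \<open>Homogeneous fields are universal, and the equivalence\<close>

lemma universal_if_homogeneous:
  assumes "open \<Omega>" and hom: "homogeneous_on \<Omega> u"
  shows "universal_for K \<Omega> u"
proof -
  note pd0 = pd_const_on[OF \<open>open \<Omega>\<close>]
  from hom obtain H :: "real ^ 3 ^ 3" and b where H: "\<And>x. x \<in> \<Omega> \<Longrightarrow> u x = H *v x + b"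
    unfolding homogeneous_on_def by blast
  have "pd m (\<lambda>y. u y $ l) x = (H *v axis m 1) $ l" if x: "x \<in> \<Omega>" for l m x
  proof -
    have "pd m (\<lambda>y. u y $ l) x = pd m (\<lambda>y. (H *v y + b) $ l) x"
      using \<open>open \<Omega>\<close> x by (rule pd_transform_open) (simp add: H)
    also have "((\<lambda>y. (H *v y + b) $ l) has_derivative (\<lambda>h. (H *v h) $ l)) (at x)"
      by (auto intro!: derivative_eq_intros bounded_linear.has_derivative[OF bounded_linear_vec_nth]
          bounded_linear.has_derivative[OF matrix_vector_mul_bounded_linear])
    then have "pd m (\<lambda>y. (H *v y + b) $ l) x = (H *v axis m 1) $ l"
      by (rule pd_eq_derivative)
    finally show ?thesis .
  qed
  then have strain: "strain u l m x = ((H *v axis m 1) $ l + (H *v axis l 1) $ m) / 2"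
    if "x \<in> \<Omega>" for l m x
    using that by (simp add: strain_def)
  then have dstrain: "pd n (strain u l m) x = 0" if "x \<in> \<Omega>" for l m n x
    by (rule pd0[OF that])
  \<comment> \<open>On \<open>\<Omega>\<close> the strain is constant and its gradient vanishes, so
    stress and hyper-stress are constant there for any moduli.\<close>
  have "equilibrium_on \<Omega> (C, M, A) u" for C M A
  proof -
    have "pd j (stress (C, M, A) u i j) x = 0" if "x \<in> \<Omega>" for i j x
      by (rule pd0[OF that]) (simp add: strain dstrain)
    moreover have "pd j (hyper_stress (C, M, A) u i j k) x = 0" if "x \<in> \<Omega>" for i j k x
      by (rule pd0[OF that]) (simp add: strain dstrain)
    then have "pd k (pd j (hyper_stress (C, M, A) u i j k)) x = 0" if "x \<in> \<Omega>" for i j k x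
      by (rule pd0[OF that])
    ultimately show ?thesis by (simp add: equilibrium_on_def)
  qed
  then show ?thesis by (auto simp: universal_for_def)
qed

theorem proposition3p2:
  fixes \<Omega> :: "(real ^ 3) set" and u :: "real ^ 3 \<Rightarrow> real ^ 3"
  assumes "open \<Omega>" and "convex \<Omega>" and "\<Omega> \<noteq> {}"
    and "displacement_field \<Omega> u"
  shows "universal_for triclinic_Z2c \<Omega> u \<longleftrightarrow> homogeneous_on \<Omega> u"
proof
  assume univ: "universal_for triclinic_Z2c \<Omega> u"
  from \<open>\<Omega> \<noteq> {}\<close> obtain x\<^sub>0 where x\<^sub>0: "x\<^sub>0 \<in> \<Omega>" by blast
  \<comment> \<open>The strain at a base point \<open>x\<^sub>0\<close> will serve as the constant
    matrix \<open>E\<close>; convexity turns the vanishing gradient into constancy.\<close>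
  have "strain u l m x = strain u l m x\<^sub>0" if "x \<in> \<Omega>" for l m x
  proof (rule constant_on_if_pd_zero[OF assms(1,2)])
    show "strain u l m differentiable_on \<Omega>"
      using strain_differentiable[OF assms(4,1)]
      by (simp add: assms(1) differentiable_on_eq_differentiable_at)
    show "pd n (strain u l m) y = 0" if "y \<in> \<Omega>" for y n
      using assms(4) univ assms(1) that by (rule universal_strain_constant)
  qed (use that x\<^sub>0 in simp)
  then show "homogeneous_on \<Omega> u"
    by (intro homogeneous_if_strain_constant[OF assms(1,2) x\<^sub>0 assms(4),
          of "\<chi> l m. strain u l m x\<^sub>0"]) simp
next
  assume "homogeneous_on \<Omega> u"
  then show "universal_for triclinic_Z2c \<Omega> u"
    by (rule universal_if_homogeneous[OF assms(1)])
qed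

end
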